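(* There is no geometric formula $\phi(x)$ over the signature of the theory of MV-algebras such that, for every MV-algebra $A$, its interpretation in $A$ is equal to $\mathrm{Rad}(A)$.
   Context: An MV-algebra is a structure $(A,\oplus,\neg,0)$ such that $(A,\oplus,0)$ is a commutative monoid, $\neg\neg x=x$, $x\oplus\neg 0=\neg 0$ and $\neg(\neg x\oplus y)\oplus y=\neg(\neg y\oplus x)\oplus x$. Write $1=\neg 0$, $x\le y$ iff $\neg x\oplus y=1$, $kx=x\oplus\cdots\oplus x$ ($k$ times). An ideal is a $\le$-downset containing $0$ and closed under $\oplus$. The radical $\mathrm{Rad}(A)$ is the intersection of all maximal ideals of $A$ ($\{0\}$ if $A$ is trivial); equivalently, the set consisting of $0$ and of all $x\neq 0$ with $kx\le\neg x$ for every $k\in\mathbb{N}$. A geometric formula is a first-order formula built from atomic formulae using finitary conjunctions, existential quantifications and arbitrary (possibly infinitary) disjunctions. The axiom of choice is assumed. *)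

theory Defs
  imports "HOL-Algebra.Group"
begin

record 'a mv = "'a partial_object" +
  mv_plus :: "'a \<Rightarrow> 'a \<Rightarrow> 'a" (infixl "\<oplus>\<index>" 65)
  mv_neg  :: "'a \<Rightarrow> 'a" ("\<sim>\<index> _" [81] 80)
  mv_zero :: 'a ("\<zero>\<index>")

locale mv_algebra =
  fixes A :: "('a, 'b) mv_scheme" (structure)
  assumes add_comm_monoid: "comm_monoid \<lparr>carrier = carrier A, monoid.mult = mv_plus A, one = mv_zero A\<rparr>"
    and neg_closed: "x \<in> carrier A \<Longrightarrow> \<sim> x \<in> carrier A"
    and neg_neg: "x \<in> carrier A \<Longrightarrow> \<sim> (\<sim> x) = x"
    and plus_neg_zero: "x \<in> carrier A \<Longrightarrow> x \<oplus> \<sim> \<zero> = \<sim> \<zero>"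
    and plus_neg_commute: "\<lbrakk>x \<in> carrier A; y \<in> carrier A\<rbrakk> \<Longrightarrow>
      \<sim> (\<sim> x \<oplus> y) \<oplus> y = \<sim> (\<sim> y \<oplus> x) \<oplus> x"

definition mv_one :: "('a, 'b) mv_scheme \<Rightarrow> 'a"
  where "mv_one A = mv_neg A (mv_zero A)"

definition mv_le :: "('a, 'b) mv_scheme \<Rightarrow> 'a \<Rightarrow> 'a \<Rightarrow> bool"
  where "mv_le A x y \<longleftrightarrow> mv_plus A (mv_neg A x) y = mv_one A"

definition mv_ideal :: "('a, 'b) mv_scheme \<Rightarrow> 'a set \<Rightarrow> bool"
  where "mv_ideal A I \<longleftrightarrow>
    I \<subseteq> carrier A \<and> mv_zero A \<in> I \<and>
    (\<forall>x\<in>I. \<forall>y\<in>carrier A. mv_le A y x \<longrightarrow> y \<in> I) \<and>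
    (\<forall>x\<in>I. \<forall>y\<in>I. mv_plus A x y \<in> I)"

definition mv_maximal_ideal :: "('a, 'b) mv_scheme \<Rightarrow> 'a set \<Rightarrow> bool"
  where "mv_maximal_ideal A I \<longleftrightarrow>
    mv_ideal A I \<and> I \<noteq> carrier A \<and>
    (\<forall>J. mv_ideal A J \<and> I \<subseteq> J \<longrightarrow> J = I \<or> J = carrier A)"

definition mv_Rad :: "('a, 'b) mv_scheme \<Rightarrow> 'a set"
  where "mv_Rad A =
    (if carrier A = {mv_zero A} then {mv_zero A} else \<Inter> {I. mv_maximal_ideal A I})"

datatype mv_term =
    Var nat
  | Zero
  | Plus mv_term mv_term
  | Neg mv_term

text \<open>
  The disjunction \<open>Disj I F\<close> is over the family of all \<open>F i\<close> with \<open>i \<in> I\<close>; the values of \<open>F\<close>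
  outside \<open>I\<close> are irrelevant, and \<open>Disj {} F\<close> is falsity. A disjunction over an arbitrary index
  set is obtained by letting the type \<open>'i\<close> vary.

  It is usually required that each formula has finitely many free variables. Every
  subformula is within the scope of only finitely many quantifiers, so this holds for all
  subformulae (in \<open>F i\<close> for \<open>i \<in> I\<close>) as soon as it holds for the whole formula.
\<close>

datatype 'i geom_formula =
    Eq mv_term mv_term
  | Truth
  | Conj "'i geom_formula" "'i geom_formula"
  | Exists nat "'i geom_formula"
  | Disj "'i set" "'i \<Rightarrow> 'i geom_formula"

primrec term_vars :: "mv_term \<Rightarrow> nat set" where
  "term_vars (Var n) = {n}"
| "term_vars Zero = {}"
| "term_vars (Plus s t) = term_vars s \<union> term_vars t"
| "term_vars (Neg t) = term_vars t"

primrec free_vars :: "'i geom_formula \<Rightarrow> nat set" where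
  "free_vars (Eq s t) = term_vars s \<union> term_vars t"
| "free_vars Truth = {}"
| "free_vars (Conj \<phi> \<psi>) = free_vars \<phi> \<union> free_vars \<psi>"
| "free_vars (Exists n \<phi>) = free_vars \<phi> - {n}"
| "free_vars (Disj I F) = (\<Union>i\<in>I. free_vars (F i))"

primrec term_val :: "('a, 'b) mv_scheme \<Rightarrow> (nat \<Rightarrow> 'a) \<Rightarrow> mv_term \<Rightarrow> 'a" where
  "term_val A e (Var n) = e n"
| "term_val A e Zero = mv_zero A"
| "term_val A e (Plus s t) = mv_plus A (term_val A e s) (term_val A e t)"
| "term_val A e (Neg t) = mv_neg A (term_val A e t)"

primrec sat :: "('a, 'b) mv_scheme \<Rightarrow> 'i geom_formula \<Rightarrow> (nat \<Rightarrow> 'a) \<Rightarrow> bool" where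
  "sat A (Eq s t) = (\<lambda>e. term_val A e s = term_val A e t)"
| "sat A Truth = (\<lambda>e. True)"
| "sat A (Conj \<phi> \<psi>) = (\<lambda>e. sat A \<phi> e \<and> sat A \<psi> e)"
| "sat A (Exists n \<phi>) = (\<lambda>e. \<exists>a\<in>carrier A. sat A \<phi> (e(n := a)))"
| "sat A (Disj I F) = (\<lambda>e. \<exists>i\<in>I. sat A (F i) e)"

text \<open>
  The interpretation of a formula in the context of a single variable \<open>x\<close>, that is, with
  \<open>free_vars \<phi> \<subseteq> {x}\<close>. The valuation matters only at \<open>x\<close>, so the constant one serves.
\<close>

definition interp :: "('a, 'b) mv_scheme \<Rightarrow> 'i geom_formula \<Rightarrow> 'a set"
  where "interp A \<phi> = {a \<in> carrier A. sat A \<phi> (\<lambda>_. a)}"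

end

theory Submission
  imports Defs "HOL-Library.Countable" "HOL-Computational_Algebra.Polynomial"
begin

text \<open>
  A geometric formula satisfied at a tuple is witnessed by finitely many elements and finitely
  many equations between them. Hence it is preserved not only by homomorphisms but by families
  of maps \<open>h\<^sub>m : C \<rightarrow> L\<^sub>m\<close> that respect every single instance of an operation for all large
  \<open>m\<close> (\<open>sat_eventual_hom\<close>). Membership in the radical is not preserved in this way.

  Let \<open>C\<close> be the interval from \<open>0\<close> to \<open>X\<close> in the integer polynomials, ordered by the sign of
  the leading coefficient of a difference. It consists of the constants \<open>n\<close> and of the polynomials
  \<open>X - n\<close> with \<open>n \<ge> 0\<close>, and is Chang's algebra, with the infinitesimal \<open>1\<close> in its radical
  (\<open>one_in_Rad_chang\<close>). Let \<open>L\<^sub>m\<close> be the interval from \<open>0\<close> to \<open>m\<close> in the integers, a finite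
  Lukasiewicz chain, which is simple and so has radical \<open>{0}\<close> (\<open>Rad_lukasiewicz\<close>). The order of
  polynomials is that of eventual domination, so evaluation at \<open>m\<close> respects the operations of \<open>C\<close>
  for large \<open>m\<close>, and it sends the infinitesimal \<open>1\<close> to \<open>1 \<noteq> 0\<close>. A geometric formula that
  defines the radical would hold at \<open>1\<close> in \<open>C\<close>, hence at \<open>1\<close> in \<open>L\<^sub>m\<close> for large \<open>m\<close>.
\<close>

section \<open>Geometric formulas and eventual homomorphisms\<close>

lemma term_val_eventual_hom:
  fixes C :: "('a, 'c) mv_scheme" and L :: "'m \<Rightarrow> ('b, 'd) mv_scheme"
  assumes zero_closed: "mv_zero C \<in> carrier C"
    and plus_closed: "\<And>x y. x \<in> carrier C \<Longrightarrow> y \<in> carrier C \<Longrightarrow> mv_plus C x y \<in> carrier C"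
    and neg_closed: "\<And>x. x \<in> carrier C \<Longrightarrow> mv_neg C x \<in> carrier C"
    and zero: "\<forall>\<^sub>F m in F. h m (mv_zero C) = mv_zero (L m)"
    and plus: "\<And>x y. x \<in> carrier C \<Longrightarrow> y \<in> carrier C \<Longrightarrow>
      \<forall>\<^sub>F m in F. h m (mv_plus C x y) = mv_plus (L m) (h m x) (h m y)"
    and neg: "\<And>x. x \<in> carrier C \<Longrightarrow> \<forall>\<^sub>F m in F. h m (mv_neg C x) = mv_neg (L m) (h m x)"
    and e: "range e \<subseteq> carrier C"
  shows "term_val C e t \<in> carrier C \<and>
    (\<forall>\<^sub>F m in F. term_val (L m) (\<lambda>n. h m (e n)) t = h m (term_val C e t))"
proof (induction t)
  case (Var n)
  then show ?case using e by auto
next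
  case Zero
  then show ?case using zero_closed zero by (auto elim: eventually_mono)
next
  case (Plus s t)
  then have s: "term_val C e s \<in> carrier C" and t: "term_val C e t \<in> carrier C" by auto
  have "\<forall>\<^sub>F m in F. term_val (L m) (\<lambda>n. h m (e n)) (Plus s t) = h m (term_val C e (Plus s t))"
    using conjunct2[OF Plus.IH(1)] conjunct2[OF Plus.IH(2)] plus[OF s t]
    by eventually_elim simp
  then show ?case using plus_closed[OF s t] by simp
next
  case (Neg t)
  then have t: "term_val C e t \<in> carrier C" by auto
  have "\<forall>\<^sub>F m in F. term_val (L m) (\<lambda>n. h m (e n)) (Neg t) = h m (term_val C e (Neg t))"
    using conjunct2[OF Neg.IH] neg[OF t] by eventually_elim simp
  then show ?case using neg_closed[OF t] by simp
qed

text \<open>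
  For a given formula and valuation, only finitely many instances of the hypotheses matter. For
  disjunctions this is because only a disjunct that holds in \<open>C\<close> is followed, so infinite ones
  are harmless; an infinite conjunction or a universal quantifier would break the argument.
\<close>

lemma sat_eventual_hom:
  fixes C :: "('a, 'c) mv_scheme" and L :: "'m \<Rightarrow> ('b, 'd) mv_scheme"
    and \<phi> :: "'i geom_formula"
  assumes zero_closed: "mv_zero C \<in> carrier C"
    and plus_closed: "\<And>x y. x \<in> carrier C \<Longrightarrow> y \<in> carrier C \<Longrightarrow> mv_plus C x y \<in> carrier C"
    and neg_closed: "\<And>x. x \<in> carrier C \<Longrightarrow> mv_neg C x \<in> carrier C"
    and closed: "\<And>x. x \<in> carrier C \<Longrightarrow> \<forall>\<^sub>F m in F. h m x \<in> carrier (L m)"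
    and zero: "\<forall>\<^sub>F m in F. h m (mv_zero C) = mv_zero (L m)"
    and plus: "\<And>x y. x \<in> carrier C \<Longrightarrow> y \<in> carrier C \<Longrightarrow>
      \<forall>\<^sub>F m in F. h m (mv_plus C x y) = mv_plus (L m) (h m x) (h m y)"
    and neg: "\<And>x. x \<in> carrier C \<Longrightarrow> \<forall>\<^sub>F m in F. h m (mv_neg C x) = mv_neg (L m) (h m x)"
    and e: "range e \<subseteq> carrier C"
    and sat: "sat C \<phi> e"
  shows "\<forall>\<^sub>F m in F. sat (L m) \<phi> (\<lambda>n. h m (e n))"
  using e sat
proof (induction \<phi> arbitrary: e)
  case (Eq s t)
  note terms = term_val_eventual_hom[where F = F and h = h and L = L,
      OF zero_closed plus_closed neg_closed zero plus neg Eq.prems(1)]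
  from Eq.prems(2) show ?case
    using conjunct2[OF terms[of s]] conjunct2[OF terms[of t]]
    by (auto elim: eventually_elim2)
next
  case Truth
  then show ?case by simp
next
  case (Conj \<phi> \<psi>)
  then show ?case by (simp add: eventually_conj)
next
  case (Exists n \<phi>)
  from Exists.prems(2) obtain a where a: "a \<in> carrier C" and "sat C \<phi> (e(n := a))" by auto
  moreover have "range (e(n := a)) \<subseteq> carrier C" using a Exists.prems(1) by auto
  ultimately have "\<forall>\<^sub>F m in F. sat (L m) \<phi> (\<lambda>k. h m ((e(n := a)) k))" by (intro Exists.IH)
  moreover have "(\<lambda>k. h m ((e(n := a)) k)) = (\<lambda>k. h m (e k))(n := h m a)" for m by auto
  ultimately have "\<forall>\<^sub>F m in F. sat (L m) \<phi> ((\<lambda>k. h m (e k))(n := h m a))" by simp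
  with closed[OF a] show ?case
    by eventually_elim auto
next
  case (Disj I G)
  then obtain i where i: "i \<in> I" and "sat C (G i) e" by auto
  then have "\<forall>\<^sub>F m in F. sat (L m) (G i) (\<lambda>n. h m (e n))" using Disj by blast
  then show ?case by eventually_elim (use i in auto)
qed

section \<open>Intervals in linearly ordered groups\<close>

text \<open>
  Mundici's MV-algebra of the interval from \<open>0\<close> to \<open>u\<close>, moved along \<open>g\<close> into another type: the
  theorem concerns a single, arbitrary infinite type of elements.
\<close>

definition interval_mv :: "('g \<Rightarrow> 'a) \<Rightarrow> 'g::linordered_ab_group_add \<Rightarrow> 'a mv" where
  "interval_mv g u = \<lparr>carrier = g ` {0..u},
     mv_plus = (\<lambda>x y. g (min u (inv_into UNIV g x + inv_into UNIV g y))),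
     mv_neg = (\<lambda>x. g (u - inv_into UNIV g x)), mv_zero = g 0\<rparr>"

context
  fixes g :: "'g::linordered_ab_group_add \<Rightarrow> 'a" and u :: 'g
  assumes g: "inj g"
begin

lemma interval_mv_simps:
  "carrier (interval_mv g u) = g ` {0..u}"
  "mv_plus (interval_mv g u) (g x) (g y) = g (min u (x + y))"
  "mv_neg (interval_mv g u) (g x) = g (u - x)"
  "mv_zero (interval_mv g u) = g 0"
  using g by (simp_all add: interval_mv_def)

lemma mv_algebra_interval:
  assumes u: "0 \<le> u"
  shows "mv_algebra (interval_mv g u)"
proof (rule mv_algebra.intro)
  fix x y
  show "\<sim>\<^bsub>interval_mv g u\<^esub> x \<in> carrier (interval_mv g u)"
    and "\<sim>\<^bsub>interval_mv g u\<^esub> (\<sim>\<^bsub>interval_mv g u\<^esub> x) = x"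
    and "x \<oplus>\<^bsub>interval_mv g u\<^esub> \<sim>\<^bsub>interval_mv g u\<^esub> \<zero>\<^bsub>interval_mv g u\<^esub>
      = \<sim>\<^bsub>interval_mv g u\<^esub> \<zero>\<^bsub>interval_mv g u\<^esub>"
    if "x \<in> carrier (interval_mv g u)"
    using that by (auto simp: interval_mv_simps min_def)
  \<comment> \<open>Both sides of the last axiom are the maximum of the two elements.\<close>
  have max: "min u (u - min u (u - a + b) + b) = max a b" if "a \<in> {0..u}" "b \<in> {0..u}" for a b
    using that by (auto simp: min_def max_def algebra_simps)
  show "\<sim>\<^bsub>interval_mv g u\<^esub> (\<sim>\<^bsub>interval_mv g u\<^esub> x \<oplus>\<^bsub>interval_mv g u\<^esub> y) \<oplus>\<^bsub>interval_mv g u\<^esub> y =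
    \<sim>\<^bsub>interval_mv g u\<^esub> (\<sim>\<^bsub>interval_mv g u\<^esub> y \<oplus>\<^bsub>interval_mv g u\<^esub> x) \<oplus>\<^bsub>interval_mv g u\<^esub> x"
    if "x \<in> carrier (interval_mv g u)" "y \<in> carrier (interval_mv g u)"
  proof -
    from that obtain a b where "x = g a" "y = g b" and ab: "a \<in> {0..u}" "b \<in> {0..u}"
      by (auto simp: interval_mv_simps)
    then show ?thesis
      by (simp only: interval_mv_simps max[OF ab] max[OF ab(2,1)] max.commute)
  qed
next
  have assoc: "min u (min u (a + b) + c) = min u (a + min u (b + c))"
    if "0 \<le> a" "0 \<le> c" for a b c
  proof -
    have "min u (min u (a + b) + c) = min (min u (u + c)) (a + b + c)"
      by (simp add: min_add_distrib_left min.assoc)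
    also have "\<dots> = min (min u (a + u)) (a + (b + c))"
      using that by (simp add: min_def add.assoc)
    also have "\<dots> = min u (a + min u (b + c))"
      by (simp add: min_add_distrib_right min.assoc)
    finally show ?thesis .
  qed
  show "comm_monoid \<lparr>carrier = carrier (interval_mv g u), monoid.mult = mv_plus (interval_mv g u),
      one = mv_zero (interval_mv g u)\<rparr>"
  proof (rule comm_monoidI, goal_cases)
    case (3 x y z)
    then obtain a b c where "x = g a" "y = g b" "z = g c" "0 \<le> a" "0 \<le> c"
      by (auto simp: interval_mv_simps)
    then show ?case by (simp add: interval_mv_simps assoc)
  qed (use u in \<open>auto simp: interval_mv_simps add.commute\<close>)
qed

lemma mv_one_interval: "mv_one (interval_mv g u) = g u"
  by (simp add: mv_one_def interval_mv_simps)

lemma mv_le_interval: "mv_le (interval_mv g u) (g x) (g y) \<longleftrightarrow> x \<le> y"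
  by (auto simp: mv_le_def mv_one_interval interval_mv_simps inj_eq[OF g] min_def algebra_simps)

lemma mv_ideal_interval:
  assumes "J \<subseteq> {0..u}"
  shows "mv_ideal (interval_mv g u) (g ` J) \<longleftrightarrow>
    0 \<in> J \<and> (\<forall>x\<in>J. {0..x} \<subseteq> J) \<and> (\<forall>x\<in>J. \<forall>y\<in>J. min u (x + y) \<in> J)"
proof -
  have "g ` J \<subseteq> g ` {0..u}" using assms by blast
  moreover have "(\<forall>y\<in>{0..u}. y \<le> x \<longrightarrow> y \<in> J) \<longleftrightarrow> {0..x} \<subseteq> J" if "x \<in> J" for x
    using that assms by fastforce
  ultimately show ?thesis
    by (simp add: mv_ideal_def interval_mv_simps mv_le_interval inj_image_mem_iff[OF g])
qed

lemma mv_ideal_interval_cases: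
  assumes "mv_ideal (interval_mv g u) I"
  obtains J where "I = g ` J" "J \<subseteq> {0..u}"
    "0 \<in> J" "\<And>x y. x \<in> J \<Longrightarrow> 0 \<le> y \<Longrightarrow> y \<le> x \<Longrightarrow> y \<in> J"
    "\<And>x y. x \<in> J \<Longrightarrow> y \<in> J \<Longrightarrow> min u (x + y) \<in> J"
proof -
  from assms obtain J where J: "I = g ` J" "J \<subseteq> {0..u}"
    by (auto simp: mv_ideal_def interval_mv_simps subset_image_iff)
  note iffD1[OF mv_ideal_interval[OF J(2)] assms[unfolded J(1)]]
  then show ?thesis by (intro that[OF J]; meson atLeastAtMost_iff subsetD)
qed

end

section \<open>Finite Lukasiewicz chains\<close>

text \<open>
  The integers are archimedean, so a nonzero element of an ideal generates the unit; hence
  \<open>{0}\<close> is a maximal ideal.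
\<close>

lemma Rad_lukasiewicz:
  fixes g :: "int \<Rightarrow> 'a"
  assumes g: "inj g" and u: "0 < u"
  shows "mv_Rad (interval_mv g u) \<subseteq> {g 0}"
proof -
  have top: "g ` J = carrier (interval_mv g u)"
    if ideal: "mv_ideal (interval_mv g u) (g ` J)" and J: "J \<subseteq> {0..u}" and x: "x \<in> J" "x \<noteq> 0"
    for J x
  proof -
    note J' = iffD1[OF mv_ideal_interval[OF g J] ideal]
    from x J have "1 \<le> x" by auto
    have multiples: "min u (int k) \<in> J" for k
    proof (induction k)
      case (Suc k)
      have "1 \<in> J" using J' x(1) \<open>1 \<le> x\<close> by (auto simp: subset_iff)
      with Suc have "min u (min u (int k) + 1) \<in> J" using J' by auto
      then show ?case by (simp add: min_def algebra_simps split: if_splits)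
    qed (use J' u in auto)
    have "u \<in> J" using multiples[of "nat u"] u by simp
    then show ?thesis using J J' by (auto simp: interval_mv_simps[OF g])
  qed
  have "mv_maximal_ideal (interval_mv g u) {g 0}"
    unfolding mv_maximal_ideal_def
  proof (intro conjI allI impI)
    show "mv_ideal (interval_mv g u) {g 0}"
      using mv_ideal_interval[OF g, of "{0}" u] u by simp
    have "g u \<in> carrier (interval_mv g u)" "g u \<noteq> g 0"
      using u by (auto simp: interval_mv_simps[OF g] inj_eq[OF g])
    then show "{g 0} \<noteq> carrier (interval_mv g u)" by auto
    fix I assume I: "mv_ideal (interval_mv g u) I \<and> {g 0} \<subseteq> I"
    then obtain J where J: "I = g ` J" "J \<subseteq> {0..u}"
      using mv_ideal_interval_cases[OF g] by metis
    show "I = {g 0} \<or> I = carrier (interval_mv g u)"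
    proof (cases "J \<subseteq> {0}")
      case True
      with I J show ?thesis by auto
    next
      case False
      with I J top show ?thesis by blast
    qed
  qed
  then show ?thesis by (auto simp: mv_Rad_def interval_mv_simps[OF g])
qed

section \<open>Chang's algebra as an interval of polynomials\<close>

text \<open>The order of integer polynomials is eventual domination of their values.\<close>

lemma eventually_poly_pos:
  fixes p :: "int poly"
  assumes "0 < p"
  shows "\<forall>\<^sub>F m in sequentially. 0 < poly p (int m)"
  using assms
proof (induction p)
  case (pCons a p)
  show ?case
  proof (cases "p = 0")
    case False
    with pCons.prems have "0 < p" by (simp add: less_poly_def pos_poly_pCons)
    from pCons.IH[OF this] eventually_gt_at_top[of "nat \<bar>a\<bar>"] show ?thesis
    proof eventually_elim
      case (elim m)
      then have "int m * 1 \<le> int m * poly p (int m)" by (intro mult_left_mono) auto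
      moreover have "\<bar>a\<bar> < int m" using elim by linarith
      ultimately show ?case by simp
    qed
  qed (use pCons.prems in \<open>simp add: less_poly_def pos_poly_pCons\<close>)
qed simp

lemma eventually_poly_mono:
  fixes p q :: "int poly"
  assumes "p \<le> q"
  shows "\<forall>\<^sub>F m in sequentially. poly p (int m) \<le> poly q (int m)"
proof (cases "p = q")
  case False
  with assms have "0 < q - p" by simp
  from eventually_poly_pos[OF this] show ?thesis by eventually_elim simp
qed simp

lemma eventually_poly_min:
  fixes p q :: "int poly"
  shows "\<forall>\<^sub>F m in sequentially. poly (min p q) (int m) = min (poly p (int m)) (poly q (int m))"
  using eventually_poly_mono[of p q] eventually_poly_mono[of q p]
  by (cases "p \<le> q") (auto simp: min_def elim: eventually_mono)

text \<open>
  The constants form a proper ideal that contains every proper ideal, because any other element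
  \<open>p\<close> satisfies \<open>X \<le> p + p\<close>. So it is the only maximal ideal, and \<open>1\<close> lies in it.
\<close>

lemma one_in_Rad_chang:
  fixes g :: "int poly \<Rightarrow> 'a"
  assumes g: "inj g"
  shows "g 1 \<in> mv_Rad (interval_mv g [:0, 1:])"
proof -
  let ?X = "[:0, 1:] :: int poly" and ?C = "interval_mv g [:0, 1:]"
  define R :: "int poly set" where "R = (\<lambda>c. [:c:]) ` {0..}"
  have less_X: "[:c:] < ?X" for c
    by (simp add: less_poly_def pos_poly_pCons)
  have R: "R \<subseteq> {0..?X}"
    by (auto simp: R_def less_X less_imp_le) (auto simp: less_eq_poly_def pos_poly_pCons)
  have R_or_large: "p \<in> R \<or> ?X \<le> p + p" if "0 \<le> p" for p
  proof (cases p)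
    case (pCons a q)
    show ?thesis
    proof (cases "q = 0")
      case True
      with that pCons show ?thesis by (auto simp: R_def less_eq_poly_def pos_poly_pCons)
    next
      case False
      with that pCons have "0 < q" by (auto simp: less_eq_poly_def less_poly_def pos_poly_pCons)
      \<comment> \<open>The leading coefficient of \<open>q\<close> is at least \<open>1\<close>, so \<open>q + q\<close> exceeds \<open>1\<close> even
        if \<open>q\<close> is constant.\<close>
      moreover from this have "0 \<le> q - 1"
        by (cases q) (auto simp: less_eq_poly_def less_poly_def pos_poly_pCons one_pCons)
      ultimately have "0 < q + (q - 1)" by (rule add_pos_nonneg)
      moreover have "p + p - ?X = pCons (a + a) (q + (q - 1))"
        using pCons by (simp add: one_pCons)
      ultimately have "0 < p + p - ?X"
        by (simp only: less_poly_def pos_poly_pCons diff_0_right simp_thms)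
      then show ?thesis by simp
    qed
  qed
  have R_ideal: "mv_ideal ?C (g ` R)"
  proof (subst mv_ideal_interval[OF g R], intro conjI ballI subsetI)
    show "0 \<in> R" by (auto simp: R_def image_iff)
    show "min ?X (p + q) \<in> R" if "p \<in> R" "q \<in> R" for p q
      using that less_X by (auto simp: R_def min_absorb2 less_imp_le)
    show "q \<in> R" if "p \<in> R" "q \<in> {0..p}" for p q
    proof (rule ccontr)
      assume "q \<notin> R"
      with that R_or_large[of q] have "?X \<le> p + p" by (auto intro: order_trans add_mono)
      moreover from that(1) obtain c where "p = [:c:]" by (auto simp: R_def)
      then have "p + p = [:c + c:]" by (simp only: add_pCons add_0_left)
      ultimately show False using less_X[of "c + c"] by simp
    qed
  qed
  have R_proper: "g ` R \<noteq> carrier ?C"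
  proof -
    have "?X \<notin> R" by (auto simp: R_def)
    then have "g ?X \<in> carrier ?C - g ` R"
      by (auto simp: interval_mv_simps[OF g] inj_image_mem_iff[OF g] less_eq_poly_def pos_poly_pCons)
    then show ?thesis by auto
  qed
  have "g 1 \<in> I" if I: "mv_maximal_ideal ?C I" for I
  proof -
    from I have ideal: "mv_ideal ?C I" and proper: "I \<noteq> carrier ?C"
      by (auto simp: mv_maximal_ideal_def)
    obtain J where J: "I = g ` J" "J \<subseteq> {0..?X}" "0 \<in> J"
      "\<And>x y. x \<in> J \<Longrightarrow> 0 \<le> y \<Longrightarrow> y \<le> x \<Longrightarrow> y \<in> J"
      "\<And>x y. x \<in> J \<Longrightarrow> y \<in> J \<Longrightarrow> min ?X (x + y) \<in> J"
      by (rule mv_ideal_interval_cases[OF g ideal]) blast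
    have "J \<subseteq> R"
    proof
      fix p assume p: "p \<in> J"
      show "p \<in> R"
      proof (rule ccontr)
        assume "p \<notin> R"
        with p J(2) R_or_large[of p] have "?X \<le> p + p" by auto
        with J(5)[OF p p] have "?X \<in> J" by (simp add: min_absorb1)
        then have "J = {0..?X}" using J(2,4) by auto
        with proper J(1) show False by (simp add: interval_mv_simps[OF g])
      qed
    qed
    then have "I = g ` R"
      using I J(1) R_ideal R_proper by (metis image_mono mv_maximal_ideal_def)
    moreover have "1 \<in> R" by (auto simp: R_def one_pCons)
    ultimately show ?thesis by auto
  qed
  moreover have "carrier ?C \<noteq> {\<zero>\<^bsub>?C\<^esub>}"
  proof -
    have "g ?X \<noteq> g 0" using g by (simp add: inj_eq)
    moreover have "g ?X \<in> carrier ?C"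
      by (auto simp: interval_mv_simps[OF g] less_eq_poly_def pos_poly_pCons)
    ultimately show ?thesis by (auto simp: interval_mv_simps[OF g])
  qed
  ultimately show ?thesis by (simp add: mv_Rad_def)
qed

section \<open>The radical is not geometric\<close>

lemma sat_chang_imp_lukasiewicz:
  fixes g :: "int poly \<Rightarrow> 'a" and g' :: "int \<Rightarrow> 'a" and \<phi> :: "'i geom_formula"
  assumes g: "inj g" and g': "inj g'" and "p \<in> {0..[:0, 1:]}"
    and "sat (interval_mv g [:0, 1:]) \<phi> (\<lambda>_. g p)"
  shows "\<forall>\<^sub>F m in sequentially. sat (interval_mv g' (int m)) \<phi> (\<lambda>_. g' (poly p (int m)))"
proof -
  let ?X = "[:0, 1:] :: int poly" and ?C = "interval_mv g [:0, 1:]"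
  let ?L = "\<lambda>m. interval_mv g' (int m)"
  define h where "h m x = g' (poly (inv_into UNIV g x) (int m))" for m x
  have h: "h m (g q) = g' (poly q (int m))" for m q by (simp add: h_def g)
  note simps = interval_mv_simps[OF g] interval_mv_simps[OF g'] h
  have X: "0 \<le> ?X" by (simp add: less_eq_poly_def pos_poly_pCons)
  have "\<forall>\<^sub>F m in sequentially. sat (?L m) \<phi> (\<lambda>_. h m (g p))"
  proof (rule sat_eventual_hom[where C = ?C])
    fix x assume "x \<in> carrier ?C"
    then obtain q where q: "x = g q" "0 \<le> q" "q \<le> ?X" by (auto simp: simps)
    show "mv_neg ?C x \<in> carrier ?C" using q by (auto simp: simps)
    show "\<forall>\<^sub>F m in sequentially. h m x \<in> carrier (?L m)"
      using eventually_poly_mono[OF q(2)] eventually_poly_mono[OF q(3)]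
      by eventually_elim (use q in \<open>auto simp: simps\<close>)
    show "\<forall>\<^sub>F m in sequentially. h m (mv_neg ?C x) = mv_neg (?L m) (h m x)"
      using q by (simp add: simps)
  next
    fix x y assume "x \<in> carrier ?C" "y \<in> carrier ?C"
    then obtain q r where qr: "x = g q" "y = g r" "0 \<le> q" "0 \<le> r" by (auto simp: simps)
    show "mv_plus ?C x y \<in> carrier ?C" using qr X by (auto simp: simps)
    show "\<forall>\<^sub>F m in sequentially. h m (mv_plus ?C x y) = mv_plus (?L m) (h m x) (h m y)"
      using eventually_poly_min[of ?X "q + r"]
      by eventually_elim (use qr in \<open>simp add: simps\<close>)
  qed (use assms X in \<open>auto simp: simps\<close>)
  then show ?thesis by (simp add: h)
qed

theorem mainTheorem19:
  assumes "infinite (UNIV :: 'a set)"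
  shows "\<not> (\<exists>(\<phi> :: 'i geom_formula) x. free_vars \<phi> \<subseteq> {x} \<and>
           (\<forall>A :: 'a mv. mv_algebra A \<longrightarrow> interp A \<phi> = mv_Rad A))"
proof
  assume "\<exists>(\<phi> :: 'i geom_formula) x. free_vars \<phi> \<subseteq> {x} \<and>
           (\<forall>A :: 'a mv. mv_algebra A \<longrightarrow> interp A \<phi> = mv_Rad A)"
  then obtain \<phi> :: "'i geom_formula"
    where Rad: "\<And>A :: 'a mv. mv_algebra A \<Longrightarrow> interp A \<phi> = mv_Rad A" by blast
  \<comment> \<open>All algebras involved are countable, hence have copies in every infinite type.\<close>
  from assms obtain f :: "nat \<Rightarrow> 'a" where f: "inj f"
    by (auto simp: infinite_iff_countable_subset)
  define g :: "int poly \<Rightarrow> 'a" where "g = f \<circ> to_nat \<circ> coeffs"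
  define g' :: "int \<Rightarrow> 'a" where "g' = f \<circ> to_nat"
  have g: "inj g" unfolding g_def
    by (intro inj_compose f inj_to_nat) (simp add: inj_def coeffs_eq_iff)
  have g': "inj g'" unfolding g'_def by (intro inj_compose f inj_to_nat)
  have X: "(0 :: int poly) \<le> [:0, 1:]" "(1 :: int poly) \<le> [:0, 1:]"
    by (simp_all add: less_eq_poly_def pos_poly_pCons one_pCons)
  have "g 1 \<in> interp (interval_mv g [:0, 1:]) \<phi>"
    using one_in_Rad_chang[OF g] Rad[OF mv_algebra_interval[OF g X(1)]] by simp
  then have "sat (interval_mv g [:0, 1:]) \<phi> (\<lambda>_. g 1)" by (simp add: interp_def)
  from sat_chang_imp_lukasiewicz[OF g g' _ this] X
  have "\<forall>\<^sub>F m in sequentially. sat (interval_mv g' (int m)) \<phi> (\<lambda>_. g' 1)" by simp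
  then have "\<forall>\<^sub>F m in sequentially. 0 < m \<and> sat (interval_mv g' (int m)) \<phi> (\<lambda>_. g' 1)"
    using eventually_gt_at_top by (rule eventually_conj[rotated])
  then obtain m where m: "0 < m" "sat (interval_mv g' (int m)) \<phi> (\<lambda>_. g' 1)"
    by (auto dest: eventually_happens)
  then have "g' 1 \<in> interp (interval_mv g' (int m)) \<phi>"
    by (simp add: interp_def interval_mv_simps[OF g'])
  then have "g' 1 \<in> mv_Rad (interval_mv g' (int m))"
    using Rad[OF mv_algebra_interval[OF g', of "int m"]] by simp
  with Rad_lukasiewicz[OF g', of "int m"] m(1) have "g' 1 = g' 0" by auto
  with g' show False by (simp add: inj_eq)
qed

end
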